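(* A surjective quandle homomorphism $f\colon A\to B$ belongs to the class $\mathcal{E}$ (that is, $\pi_0(f)\colon\pi_0(A)\to\pi_0(B)$ is an isomorphism) if and only if $\mathrm{Eq}(f)\subset\ \sim_{\mathrm{Inn}(A)}$.
   Context: A quandle is a set $A$ with two binary operations $\lhd,\lhd^{-1}$ such that for all $a,b,c\in A$: (A1) $a\lhd a=a=a\lhd^{-1}a$; (A2) $(a\lhd b)\lhd^{-1}b=a=(a\lhd^{-1}b)\lhd b$; (A3) $(a\lhd b)\lhd c=(a\lhd c)\lhd(b\lhd c)$ and $(a\lhd^{-1}b)\lhd^{-1}c=(a\lhd^{-1}c)\lhd^{-1}(b\lhd^{-1}c)$. Quandle homomorphisms are maps preserving both operations. For $b\in A$, the map $\rho_b\colon A\to A$, $\rho_b(a)=a\lhd b$, is an automorphism of $A$; $\mathrm{Inn}(A)$ is the subgroup of the automorphism group of $A$ generated by all $\rho_b$, $b\in A$. Write $a\sim_{\mathrm{Inn}(A)}b$ when $a$ and $b$ lie in the same $\mathrm{Inn}(A)$-orbit; the orbits are the connected components of $A$. $\pi_0(A)$ is the set of connected components of $A$, viewed as a trivial quandle (one with $a\lhd b=a$ for all $a,b$), and $\pi_0$ is a functor from quandles to trivial quandles, with $\pi_0(f)$ sending the component of $a$ to the component of $f(a)$. $\mathrm{Eq}(f)=\{(a,a')\in A\times A\mid f(a)=f(a')\}$. The class $\mathcal{E}$ consists of the surjective quandle homomorphisms $f$ such that $\pi_0(f)$ is an isomorphism. *)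

theory Defs
  imports "HOL-Algebra.Algebra"
begin

record 'a quandle = "'a partial_object" +
  lhd :: "['a, 'a] \<Rightarrow> 'a"  (infixl \<open>\<triangleleft>\<index>\<close> 70)
  lhd_inv :: "['a, 'a] \<Rightarrow> 'a"  (infixl \<open>\<triangleleft>\<inverse>\<index>\<close> 70)

locale quandle =
  fixes A (structure)
  assumes op_closed [simp, intro]:
      "\<lbrakk>a \<in> carrier A; b \<in> carrier A\<rbrakk> \<Longrightarrow> a \<triangleleft> b \<in> carrier A"
    and inv_closed [simp, intro]:
      "\<lbrakk>a \<in> carrier A; b \<in> carrier A\<rbrakk> \<Longrightarrow> a \<triangleleft>\<inverse> b \<in> carrier A"
    and op_idem [simp]: "a \<in> carrier A \<Longrightarrow> a \<triangleleft> a = a"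
    and inv_idem [simp]: "a \<in> carrier A \<Longrightarrow> a \<triangleleft>\<inverse> a = a"
    and op_inv_cancel [simp]:
      "\<lbrakk>a \<in> carrier A; b \<in> carrier A\<rbrakk> \<Longrightarrow> (a \<triangleleft> b) \<triangleleft>\<inverse> b = a"
    and inv_op_cancel [simp]:
      "\<lbrakk>a \<in> carrier A; b \<in> carrier A\<rbrakk> \<Longrightarrow> (a \<triangleleft>\<inverse> b) \<triangleleft> b = a"
    and op_distrib:
      "\<lbrakk>a \<in> carrier A; b \<in> carrier A; c \<in> carrier A\<rbrakk>
        \<Longrightarrow> (a \<triangleleft> b) \<triangleleft> c = (a \<triangleleft> c) \<triangleleft> (b \<triangleleft> c)"
    and inv_distrib:
      "\<lbrakk>a \<in> carrier A; b \<in> carrier A; c \<in> carrier A\<rbrakk>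
        \<Longrightarrow> (a \<triangleleft>\<inverse> b) \<triangleleft>\<inverse> c = (a \<triangleleft>\<inverse> c) \<triangleleft>\<inverse> (b \<triangleleft>\<inverse> c)"

definition quandle_hom ::
  "('a, 'm) quandle_scheme \<Rightarrow> ('b, 'n) quandle_scheme \<Rightarrow> ('a \<Rightarrow> 'b) set"
  where "quandle_hom A B =
    {f \<in> carrier A \<rightarrow> carrier B. \<forall>a\<in>carrier A. \<forall>a'\<in>carrier A.
       f (a \<triangleleft>\<^bsub>A\<^esub> a') = f a \<triangleleft>\<^bsub>B\<^esub> f a' \<and> f (a \<triangleleft>\<inverse>\<^bsub>A\<^esub> a') = f a \<triangleleft>\<inverse>\<^bsub>B\<^esub> f a'}"

definition quandle_iso ::
  "('a, 'm) quandle_scheme \<Rightarrow> ('b, 'n) quandle_scheme \<Rightarrow> ('a \<Rightarrow> 'b) set"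
  where "quandle_iso A B =
    {f \<in> quandle_hom A B. \<exists>g\<in>quandle_hom B A.
       (\<forall>a\<in>carrier A. g (f a) = a) \<and> (\<forall>b\<in>carrier B. f (g b) = b)}"

text \<open>
  As for \<^const>\<open>AutoGroup\<close>, automorphisms are extensional on the carrier, so that
  each of them is represented by exactly one function.
\<close>

definition quandle_Aut :: "('a, 'm) quandle_scheme \<Rightarrow> ('a \<Rightarrow> 'a) monoid"
  where "quandle_Aut A =
    BijGroup (carrier A) \<lparr>carrier := quandle_iso A A \<inter> Bij (carrier A)\<rparr>"

definition rho :: "('a, 'm) quandle_scheme \<Rightarrow> 'a \<Rightarrow> 'a \<Rightarrow> 'a"
  where "rho A b = (\<lambda>a\<in>carrier A. a \<triangleleft>\<^bsub>A\<^esub> b)"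

definition Inn :: "('a, 'm) quandle_scheme \<Rightarrow> ('a \<Rightarrow> 'a) monoid"
  where "Inn A =
    quandle_Aut A \<lparr>carrier := generate (quandle_Aut A) (rho A ` carrier A)\<rparr>"

definition component :: "('a, 'm) quandle_scheme \<Rightarrow> 'a \<Rightarrow> 'a set"
  where "component A a = orbit (Inn A) (\<lambda>g. g) a"

definition components :: "('a, 'm) quandle_scheme \<Rightarrow> 'a set set"
  where "components A = orbits (Inn A) (carrier A) (\<lambda>g. g)"

definition sim_Inn :: "('a, 'm) quandle_scheme \<Rightarrow> ('a \<times> 'a) set"
  where "sim_Inn A = {(a, b). \<exists>C\<in>components A. a \<in> C \<and> b \<in> C}"

definition trivial_quandle :: "'a set \<Rightarrow> 'a quandle"
  where "trivial_quandle S = \<lparr>carrier = S, lhd = (\<lambda>a b. a), lhd_inv = (\<lambda>a b. a)\<rparr>"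

definition pi0 :: "('a, 'm) quandle_scheme \<Rightarrow> 'a set quandle"
  where "pi0 A = trivial_quandle (components A)"

text \<open>
  The value does not depend on the chosen representative when \<open>f\<close> is a homomorphism:
  see \<open>pi0_map_component\<close> below.
\<close>

definition pi0_map :: "('b, 'n) quandle_scheme \<Rightarrow> ('a \<Rightarrow> 'b) \<Rightarrow> 'a set \<Rightarrow> 'b set"
  where "pi0_map B f C = component B (f (SOME a. a \<in> C))"

definition Eq :: "('a, 'm) quandle_scheme \<Rightarrow> ('a \<Rightarrow> 'b) \<Rightarrow> ('a \<times> 'a) set"
  where "Eq A f = {(a, a') \<in> carrier A \<times> carrier A. f a = f a'}"

definition class_E ::
  "('a, 'm) quandle_scheme \<Rightarrow> ('b, 'n) quandle_scheme \<Rightarrow> ('a \<Rightarrow> 'b) set"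
  where "class_E A B =
    {f \<in> quandle_hom A B. f ` carrier A = carrier B \<and>
       pi0_map B f \<in> quandle_iso (pi0 A) (pi0 B)}"


lemma quandle_trivial_quandle: "quandle (trivial_quandle S)"
  by unfold_locales (auto simp: trivial_quandle_def)

lemma quandle_iso_Bij:
  assumes "f \<in> quandle_iso A A" "f \<in> extensional (carrier A)"
  shows "f \<in> Bij (carrier A)"
proof -
  obtain g where g: "g \<in> quandle_hom A A"
    "\<forall>a\<in>carrier A. g (f a) = a" "\<forall>b\<in>carrier A. f (g b) = b"
    using assms(1) by (auto simp: quandle_iso_def)
  have "bij_betw f (carrier A) (carrier A)"
    using g assms(1)
    by (intro bij_betw_byWitness[where f' = g]) (auto simp: quandle_iso_def quandle_hom_def)
  then show ?thesis using assms(2) by (simp add: Bij_def)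
qed

lemma quandle_hom_compose:
  assumes "g \<in> quandle_hom A B" "f \<in> quandle_hom B C" "quandle A"
  shows "compose (carrier A) f g \<in> quandle_hom A C"
  using assms quandle.op_closed[of A] quandle.inv_closed[of A]
  by (auto simp: quandle_hom_def compose_def Pi_iff)

context quandle
begin

lemma id_iso: "(\<lambda>a\<in>carrier A. a) \<in> quandle_iso A A"
proof -
  have "(\<lambda>a\<in>carrier A. a) \<in> quandle_hom A A" by (auto simp: quandle_hom_def)
  then show ?thesis
    by (auto simp: quandle_iso_def intro!: bexI[where x = "\<lambda>a\<in>carrier A. a"])
qed

lemma iso_compose:
  assumes "f \<in> quandle_iso A A" "g \<in> quandle_iso A A"
  shows "compose (carrier A) f g \<in> quandle_iso A A"
proof -
  obtain f' g' where inv: "f' \<in> quandle_hom A A" "g' \<in> quandle_hom A A"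
    "\<forall>a\<in>carrier A. f' (f a) = a" "\<forall>a\<in>carrier A. f (f' a) = a"
    "\<forall>a\<in>carrier A. g' (g a) = a" "\<forall>a\<in>carrier A. g (g' a) = a"
    using assms unfolding quandle_iso_def by blast
  have hom: "f \<in> quandle_hom A A" "g \<in> quandle_hom A A"
    using assms by (auto simp: quandle_iso_def)
  have maps: "\<And>h a. h \<in> quandle_hom A A \<Longrightarrow> a \<in> carrier A \<Longrightarrow> h a \<in> carrier A"
    by (auto simp: quandle_hom_def)
  have "compose (carrier A) f g \<in> quandle_hom A A"
    and "compose (carrier A) g' f' \<in> quandle_hom A A"
    using quandle_hom_compose[OF hom(2,1)] quandle_hom_compose[OF inv(1,2)] quandle_axioms
    by auto
  then show ?thesis
    using inv maps hom unfolding quandle_iso_def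
    by (auto simp: compose_def intro!: bexI[where x = "compose (carrier A) g' f'"])
qed

lemma iso_inv_into:
  assumes "f \<in> quandle_iso A A" "f \<in> Bij (carrier A)"
  shows "(\<lambda>a\<in>carrier A. inv_into (carrier A) f a) \<in> quandle_iso A A"
proof -
  obtain g where g: "g \<in> quandle_hom A A"
    "\<forall>a\<in>carrier A. g (f a) = a" "\<forall>b\<in>carrier A. f (g b) = b"
    using assms(1) by (auto simp: quandle_iso_def)
  have f: "f \<in> quandle_hom A A" using assms(1) by (simp add: quandle_iso_def)
  have "inv_into (carrier A) f a = g a" if "a \<in> carrier A" for a
    using that g assms(2)
    by (intro inv_into_f_eq) (auto simp: Bij_def bij_betw_def quandle_hom_def)
  then have "restrict (inv_into (carrier A) f) (carrier A) = restrict g (carrier A)"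
    by (auto simp: restrict_def)
  moreover have "restrict g (carrier A) \<in> quandle_iso A A"
    using f g by (auto simp: quandle_iso_def quandle_hom_def Pi_iff intro!: bexI[where x = f])
  ultimately show ?thesis by simp
qed

lemma subgroup_quandle_Aut:
  "subgroup (quandle_iso A A \<inter> Bij (carrier A)) (BijGroup (carrier A))"
proof
  fix f assume "f \<in> quandle_iso A A \<inter> Bij (carrier A)"
  then show "inv\<^bsub>BijGroup (carrier A)\<^esub> f \<in> quandle_iso A A \<inter> Bij (carrier A)"
    by (simp add: inv_BijGroup iso_inv_into restrict_inv_into_Bij del: restrict_apply)
qed (auto simp: BijGroup_def id_iso id_Bij iso_compose compose_Bij)

lemma group_quandle_Aut: "group (quandle_Aut A)"
  unfolding quandle_Aut_def
  by (rule subgroup.subgroup_is_group[OF subgroup_quandle_Aut group_BijGroup])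

lemma inv_quandle_Aut:
  assumes "f \<in> carrier (quandle_Aut A)"
  shows "inv\<^bsub>quandle_Aut A\<^esub> f = (\<lambda>a\<in>carrier A. inv_into (carrier A) f a)"
  using assms group.m_inv_consistent[OF group_BijGroup subgroup_quandle_Aut, of f]
  by (auto simp: quandle_Aut_def inv_BijGroup)

lemma rho_in_Aut:
  assumes b: "b \<in> carrier A"
  shows "rho A b \<in> carrier (quandle_Aut A)"
proof -
  let ?r = "\<lambda>a\<in>carrier A. a \<triangleleft>\<inverse> b"
  have dist: "(a \<triangleleft>\<inverse> c) \<triangleleft> b = (a \<triangleleft> b) \<triangleleft>\<inverse> (c \<triangleleft> b)" if "a \<in> carrier A" "c \<in> carrier A" for a c
    using that b op_distrib[of "a \<triangleleft>\<inverse> c" c b]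
    by (metis inv_closed inv_op_cancel op_closed op_inv_cancel)
  have h: "rho A b \<in> quandle_hom A A"
    unfolding quandle_hom_def using b op_distrib[OF _ _ b] dist
    by (simp add: rho_def del: op_idem inv_idem)
  have dist': "(a \<triangleleft> c) \<triangleleft>\<inverse> b = (a \<triangleleft>\<inverse> b) \<triangleleft> (c \<triangleleft>\<inverse> b)" if "a \<in> carrier A" "c \<in> carrier A" for a c
    using that b inv_distrib[of "a \<triangleleft> c" c b]
    by (metis inv_closed inv_op_cancel op_closed op_inv_cancel)
  have h': "?r \<in> quandle_hom A A"
    unfolding quandle_hom_def using b inv_distrib[OF _ _ b] dist'
    by (simp del: op_idem inv_idem)
  have "rho A b \<in> quandle_iso A A"
    unfolding quandle_iso_def using h h' b
    by (auto simp: rho_def intro!: bexI[where x = ?r])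
  moreover from this have "rho A b \<in> Bij (carrier A)"
    by (rule quandle_iso_Bij) (simp add: rho_def)
  ultimately show ?thesis by (simp add: quandle_Aut_def)
qed

lemma subgroup_Inn: "subgroup (carrier (Inn A)) (quandle_Aut A)"
  unfolding Inn_def
  using group.generate_is_subgroup[OF group_quandle_Aut, of "rho A ` carrier A"] rho_in_Aut
  by (simp add: image_subset_iff)

lemma group_action_Inn: "group_action (Inn A) (carrier A) (\<lambda>g. g)"
proof (intro group_action.intro group_hom.intro group_hom_axioms.intro)
  show "Group.group (Inn A)"
    using subgroup.subgroup_is_group[OF subgroup_Inn group_quandle_Aut]
    by (simp add: Inn_def)
  show "Group.group (BijGroup (carrier A))" by (rule group_BijGroup)
  have "carrier (Inn A) \<subseteq> carrier (BijGroup (carrier A))"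
    using subgroup.subset[OF subgroup_Inn] by (auto simp: quandle_Aut_def BijGroup_def)
  then show "(\<lambda>g. g) \<in> hom (Inn A) (BijGroup (carrier A))"
    by (auto simp: hom_def Inn_def quandle_Aut_def)
qed

lemma components_eq: "components A = component A ` carrier A"
  by (auto simp: components_def component_def orbits_def)

lemma component_self: "a \<in> carrier A \<Longrightarrow> a \<in> component A a"
  unfolding component_def by (rule group_action.orbit_refl[OF group_action_Inn])

lemma component_subset: "a \<in> carrier A \<Longrightarrow> component A a \<subseteq> carrier A"
  using group_action.element_image[OF group_action_Inn]
  by (auto simp: component_def orbit_def)

lemma component_eqI:
  assumes "a \<in> carrier A" "b \<in> component A a"
  shows "component A b = component A a"
proof -
  have b: "b \<in> carrier A" using assms component_subset by blast
  have a': "a \<in> component A b"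
    using group_action.orbit_sym[OF group_action_Inn assms(1) b] assms(2)
    by (simp add: component_def)
  have sub: "component A y \<subseteq> component A x"
    if "x \<in> carrier A" "y \<in> carrier A" "y \<in> component A x" for x y
  proof
    fix z assume z: "z \<in> component A y"
    then have "z \<in> carrier A" using component_subset[OF that(2)] by blast
    then show "z \<in> component A x"
      using group_action.orbit_trans[OF group_action_Inn that(1,2)] that(3) z
      by (simp add: component_def)
  qed
  show ?thesis
    using sub[OF assms(1) b assms(2)] sub[OF b assms(1) a'] by (rule equalityI)
qed

lemma sim_Inn_iff:
  "(a, b) \<in> sim_Inn A \<longleftrightarrow>
    a \<in> carrier A \<and> b \<in> carrier A \<and> component A a = component A b"
proof
  assume "(a, b) \<in> sim_Inn A"
  then obtain c where "c \<in> carrier A" "a \<in> component A c" "b \<in> component A c"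
    by (auto simp: sim_Inn_def components_eq)
  then show "a \<in> carrier A \<and> b \<in> carrier A \<and> component A a = component A b"
    using component_eqI[of c] component_subset[of c] by auto
next
  assume "a \<in> carrier A \<and> b \<in> carrier A \<and> component A a = component A b"
  then show "(a, b) \<in> sim_Inn A"
    using component_self[of a] component_self[of b]
    by (auto simp: sim_Inn_def components_eq)
qed

lemma equiv_sim_Inn: "equiv (carrier A) (sim_Inn A)"
  by (rule equivI) (auto simp: refl_on_def sym_def trans_def sim_Inn_iff)

end

lemma hom_component:
  assumes A: "quandle A" and B: "quandle B" and f: "f \<in> quandle_hom A B"
    and a: "a \<in> carrier A" and b: "b \<in> component A a"
  shows "component B (f b) = component B (f a)"
proof -
  interpret A: quandle A by fact
  interpret B: quandle B by fact
  have f_in: "f x \<in> carrier B" if "x \<in> carrier A" for x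
    using f that by (auto simp: quandle_hom_def)
  have step: "component B (f (x \<triangleleft>\<^bsub>A\<^esub> c)) = component B (f x)"
    if "x \<in> carrier A" "c \<in> carrier A" for x c
  proof (rule B.component_eqI)
    have "rho B (f c) \<in> carrier (Inn B)"
      using f_in that by (auto simp: Inn_def intro: generate.incl)
    moreover have "f (x \<triangleleft>\<^bsub>A\<^esub> c) = rho B (f c) (f x)"
      using f f_in that by (auto simp: quandle_hom_def rho_def)
    ultimately show "f (x \<triangleleft>\<^bsub>A\<^esub> c) \<in> component B (f x)"
      unfolding component_def orbit_def by blast
  qed (use f_in that in simp)
  have "\<forall>x\<in>carrier A. g x \<in> carrier A \<and> component B (f (g x)) = component B (f x)"
    if "g \<in> generate (quandle_Aut A) (rho A ` carrier A)" for g
    using that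
  proof (induction rule: generate.induct)
    case one
    then show ?case by (simp add: quandle_Aut_def BijGroup_def)
  next
    case (incl h)
    then show ?case using step by (auto simp: rho_def)
  next
    case (inv h)
    then obtain c where c: "c \<in> carrier A" "h = rho A c" by auto
    have hA: "h \<in> carrier (quandle_Aut A)" using c A.rho_in_Aut by simp
    then have "inj_on h (carrier A)"
      by (simp add: quandle_Aut_def Bij_def bij_betw_def)
    then have "inv_into (carrier A) h x = x \<triangleleft>\<inverse>\<^bsub>A\<^esub> c" if "x \<in> carrier A" for x
      using that c by (intro inv_into_f_eq) (auto simp: rho_def)
    moreover have "component B (f (x \<triangleleft>\<inverse>\<^bsub>A\<^esub> c)) = component B (f x)"
      if "x \<in> carrier A" for x
      using step[of "x \<triangleleft>\<inverse>\<^bsub>A\<^esub> c" c] c that by simp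
    ultimately show ?case
      using c A.inv_quandle_Aut[OF hA] by simp
  next
    case (eng g h)
    then have "g \<in> carrier (quandle_Aut A)" "h \<in> carrier (quandle_Aut A)"
      using subgroup.subset[OF A.subgroup_Inn] by (auto simp: Inn_def)
    then show ?case
      using eng by (auto simp: quandle_Aut_def BijGroup_def compose_def)
  qed
  moreover obtain g where "g \<in> generate (quandle_Aut A) (rho A ` carrier A)" "b = g a"
    using b by (auto simp: component_def orbit_def Inn_def)
  ultimately show ?thesis using a by simp
qed

lemma pi0_map_component:
  assumes "quandle A" "quandle B" "f \<in> quandle_hom A B" "a \<in> carrier A"
  shows "pi0_map B f (component A a) = component B (f a)"
  unfolding pi0_map_def
  using assms by (intro hom_component) (auto intro: someI quandle.component_self)

end

theory Submission
  imports Defs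
begin

text \<open>
  Since \<open>f\<close> is surjective, so is \<open>\<pi>\<^sub>0(f)\<close>, hence only injectivity matters. Every inner
  automorphism of \<open>B\<close> lifts along \<open>f\<close>: replace each generator \<open>\<rho>\<^sub>b\<close> by some \<open>\<rho>\<^sub>c\<close> with
  \<open>f c = b\<close>. So the component of \<open>f a\<close> is the image of the component of \<open>a\<close>. Thus if
  \<open>f a\<close> and \<open>f b\<close> are connected, then \<open>f b = f x\<close> for some \<open>x\<close> connected to \<open>a\<close>, and
  \<open>Eq(f) \<subseteq> \<sim>\<close> connects \<open>x\<close> to \<open>b\<close>.
\<close>

text \<open>Both operations are first projections, so every map between the underlying sets
  preserves them and a set-theoretic inverse is automatically a homomorphism.\<close>

lemma quandle_iso_trivial_quandle_iff:
  "h \<in> quandle_iso (trivial_quandle S) (trivial_quandle T) \<longleftrightarrow> bij_betw h S T"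
proof
  assume "h \<in> quandle_iso (trivial_quandle S) (trivial_quandle T)"
  then obtain k where "h \<in> S \<rightarrow> T" "k \<in> T \<rightarrow> S" "\<forall>a\<in>S. k (h a) = a" "\<forall>b\<in>T. h (k b) = b"
    by (auto simp: quandle_iso_def quandle_hom_def trivial_quandle_def)
  then show "bij_betw h S T"
    by (intro bij_betw_byWitness[where f' = k]) auto
next
  assume h: "bij_betw h S T"
  then have "bij_betw (inv_into S h) T S" by (rule bij_betw_inv_into)
  then show "h \<in> quandle_iso (trivial_quandle S) (trivial_quandle T)"
    using h
    by (auto simp: quandle_iso_def quandle_hom_def trivial_quandle_def bij_betw_apply
        bij_betw_inv_into_left bij_betw_inv_into_right intro!: bexI[where x = "inv_into S h"])
qed

context quandle
begin

lemma lhd_in_component: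
  assumes "a \<in> carrier A" "b \<in> carrier A"
  shows "a \<triangleleft> b \<in> component A a"
proof -
  have "rho A b \<in> carrier (Inn A)" using assms by (auto simp: Inn_def intro: generate.incl)
  moreover have "a \<triangleleft> b = rho A b a" using assms by (simp add: rho_def)
  ultimately show ?thesis unfolding component_def orbit_def by blast
qed

text \<open>Acting by \<open>b\<close> brings the new point back to \<open>a\<close>, so symmetry of
  components reduces this to \<open>lhd_in_component\<close>.\<close>

lemma lhd_inv_in_component:
  assumes "a \<in> carrier A" "b \<in> carrier A"
  shows "a \<triangleleft>\<inverse> b \<in> component A a"
proof -
  have c: "a \<triangleleft>\<inverse> b \<in> carrier A" using assms by simp
  have "a \<in> component A (a \<triangleleft>\<inverse> b)" using lhd_in_component[OF c assms(2)] assms by simp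
  then have "component A a = component A (a \<triangleleft>\<inverse> b)" by (rule component_eqI[OF c])
  then show ?thesis using component_self[OF c] by (rule ssubst)
qed

text \<open>Evaluates the group inverse of a generator, as the \<open>inv\<close> case of
  \<open>component_lift\<close> requires.\<close>

lemma inv_rho_apply:
  assumes "a \<in> carrier A" "b \<in> carrier A"
  shows "(inv\<^bsub>quandle_Aut A\<^esub> rho A b) a = a \<triangleleft>\<inverse> b"
proof -
  have rho: "rho A b \<in> carrier (quandle_Aut A)" using assms(2) by (rule rho_in_Aut)
  then have "inj_on (rho A b) (carrier A)"
    by (simp add: quandle_Aut_def Bij_def bij_betw_def)
  then have "inv_into (carrier A) (rho A b) a = a \<triangleleft>\<inverse> b"
    using assms by (intro inv_into_f_eq) (auto simp: rho_def)
  then show ?thesis using assms by (simp add: inv_quandle_Aut[OF rho])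
qed

end

text \<open>Complements \<open>hom_component\<close>, by which \<open>f\<close> maps
  \<open>component A a\<close> into \<open>component B (f a)\<close>: here every point of the latter
  is reached.\<close>

lemma component_lift:
  assumes A: "quandle A" and B: "quandle B" and f: "f \<in> quandle_hom A B"
    and surj: "f ` carrier A = carrier B"
    and a: "a \<in> carrier A" and b: "b \<in> component B (f a)"
  obtains x where "x \<in> component A a" "f x = b"
proof -
  interpret A: quandle A by fact
  interpret B: quandle B by fact
  have hom: "f (x \<triangleleft>\<^bsub>A\<^esub> y) = f x \<triangleleft>\<^bsub>B\<^esub> f y" "f (x \<triangleleft>\<inverse>\<^bsub>A\<^esub> y) = f x \<triangleleft>\<inverse>\<^bsub>B\<^esub> f y"
    if "x \<in> carrier A" "y \<in> carrier A" for x y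
    using f that by (simp_all add: quandle_hom_def)
  have f_in: "f x \<in> carrier B" if "x \<in> carrier A" for x
    using f that by (auto simp: quandle_hom_def)
  \<comment> \<open>The lifting is pointwise: no single automorphism of \<open>A\<close> over
    \<open>g\<close> is chosen. Quantifying over all \<open>x\<close> lets the product case restart
    at an intermediate point.\<close>
  have "\<forall>x\<in>carrier A. \<exists>x'\<in>component A x. f x' = g (f x)"
    if "g \<in> generate (quandle_Aut B) (rho B ` carrier B)" for g
    using that
  proof (induction rule: generate.induct)
    case one
    then show ?case
      using f_in A.component_self by (auto simp: quandle_Aut_def BijGroup_def)
  next
    case (incl h)
    then obtain c where c: "c \<in> carrier A" "h = rho B (f c)"
      by (auto simp flip: surj)
    then have "f (x \<triangleleft>\<^bsub>A\<^esub> c) = h (f x)" if "x \<in> carrier A" for x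
      using that c(1) hom f_in by (simp add: c(2) rho_def)
    then show ?case using c A.lhd_in_component by blast
  next
    case (inv h)
    then obtain c where c: "c \<in> carrier A" "h = rho B (f c)"
      by (auto simp flip: surj)
    then have "f (x \<triangleleft>\<inverse>\<^bsub>A\<^esub> c) = (inv\<^bsub>quandle_Aut B\<^esub> h) (f x)" if "x \<in> carrier A" for x
      using that c(1) hom f_in by (simp add: c(2) B.inv_rho_apply)
    then show ?case using c A.lhd_inv_in_component by blast
  next
    case (eng g h)
    then have gh: "g \<in> carrier (quandle_Aut B)" "h \<in> carrier (quandle_Aut B)"
      using subgroup.subset[OF B.subgroup_Inn] by (auto simp: Inn_def)
    show ?case
    proof
      fix x assume x: "x \<in> carrier A"
      \<comment> \<open>The product acts by \<open>h\<close> first: lift \<open>h\<close> from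
        \<open>x\<close> to \<open>y\<close>, then \<open>g\<close> from \<open>y\<close> to
        \<open>z\<close>.\<close>
      obtain y where y: "y \<in> component A x" "f y = h (f x)" using eng.IH(2) x by blast
      then have yA: "y \<in> carrier A" using A.component_subset x by blast
      obtain z where z: "z \<in> component A y" "f z = g (f y)" using eng.IH(1) yA by blast
      have "z \<in> component A x" using z(1) A.component_eqI[OF x y(1)] by simp
      moreover have "f z = (g \<otimes>\<^bsub>quandle_Aut B\<^esub> h) (f x)"
        using z(2) y(2) gh f_in x by (simp add: quandle_Aut_def BijGroup_def compose_def)
      ultimately show "\<exists>x'\<in>component A x. f x' = (g \<otimes>\<^bsub>quandle_Aut B\<^esub> h) (f x)" by blast
    qed
  qed
  moreover obtain g where "g \<in> generate (quandle_Aut B) (rho B ` carrier B)" "b = g (f a)"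
    using b by (auto simp: component_def orbit_def Inn_def)
  ultimately show thesis using a that by blast
qed

theorem proposition2p6:
  fixes A :: "('a, 'm) quandle_scheme" and B :: "('b, 'n) quandle_scheme"
    and f :: "'a \<Rightarrow> 'b"
  assumes "quandle A" and "quandle B"
    and "f \<in> quandle_hom A B" and "f ` carrier A = carrier B"
  shows "f \<in> class_E A B \<longleftrightarrow> Eq A f \<subseteq> sim_Inn A"
proof -
  interpret A: quandle A by fact
  interpret B: quandle B by fact
  note pi0 = pi0_map_component[OF assms(1-3)]
  have "pi0_map B f ` components A = components B"
    by (simp add: A.components_eq B.components_eq image_image pi0 flip: assms(4))
  then have class_E: "f \<in> class_E A B \<longleftrightarrow> inj_on (pi0_map B f) (components A)"
    using assms by (simp add: class_E_def pi0_def quandle_iso_trivial_quandle_iff bij_betw_def)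
  show ?thesis
  proof
    assume "f \<in> class_E A B"
    then have inj: "inj_on (pi0_map B f) (components A)" by (simp add: class_E)
    show "Eq A f \<subseteq> sim_Inn A"
    proof clarify
      fix a b assume "(a, b) \<in> Eq A f"
      then have ab: "a \<in> carrier A" "b \<in> carrier A" "f a = f b" by (auto simp: Eq_def)
      \<comment> \<open>By \<open>pi0\<close>, both components are sent to the component of the
        common value \<open>f a = f b\<close>.\<close>
      then have "component A a = component A b"
        by (intro inj_onD[OF inj]) (simp_all add: pi0 A.components_eq)
      then show "(a, b) \<in> sim_Inn A" using ab by (simp add: A.sim_Inn_iff)
    qed
  next
    assume sub: "Eq A f \<subseteq> sim_Inn A"
    have comp_eq: "component A a = component A b"
      if ab: "a \<in> carrier A" "b \<in> carrier A" "component B (f a) = component B (f b)" for a b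
    proof -
      have "f b \<in> component B (f a)" using ab(2,3) B.component_self[of "f b"] assms(4) by auto
      \<comment> \<open>The lift \<open>x\<close> of \<open>f b\<close> may differ from
        \<open>b\<close>, but both lie in one fibre of \<open>f\<close>, which is where
        \<open>sub\<close> applies.\<close>
      then obtain x where x: "x \<in> component A a" "f x = f b"
        using component_lift[OF assms ab(1)] by blast
      then have "(x, b) \<in> Eq A f" using ab A.component_subset by (auto simp: Eq_def)
      then have "component A x = component A b" using sub A.sim_Inn_iff by blast
      then show ?thesis using A.component_eqI[OF ab(1) x(1)] by simp
    qed
    show "f \<in> class_E A B"
      \<comment> \<open>\<open>class_E\<close> is the local equivalence with injectivity; writing
        components as \<open>component A a\<close> makes \<open>pi0\<close> applicable.\<close>
      unfolding class_E A.components_eq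
    proof (rule inj_onI, clarify)
      fix a b assume "a \<in> carrier A" "b \<in> carrier A"
        and "pi0_map B f (component A a) = pi0_map B f (component A b)"
      then show "component A a = component A b" by (intro comp_eq) (simp_all add: pi0)
    qed
  qed
qed

end
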